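(* Let $E\subseteq\mathbb R^{+}$ and suppose that $0$ is an accumulation point of $E$. Then the following conditions are equivalent. (i) $E\in I(\mathbf{CSP})$. (ii) The set $\mathrm{Cc}^{1}E(q)$ is infinite for every $q>1$, and there are $q_0>1$ and $M\in\mathbb N$ such that for all $q>q_0$, writing $\mathrm{Cc}^{1}E(q)=\{(a_i,b_i)\}_{i\in\mathbb N}$, we have $$\limsup_{i\to\infty}\frac{b_i}{a_i}<\infty\quad\text{and}\quad\lim_{n\to\infty}\ \max_{0\le j\le M}\frac{a_{n+j}}{b_{n+j+1}}=\infty.$$
   Context: $\mathbb R^{+}=[0,\infty)$ and $\mathbb N=\{1,2,\dots\}$. For $E\subseteq\mathbb R^{+}$ and $h>0$, $\lambda(E,0,h)$ is the length of the largest open subinterval of $(0,h)$ (possibly empty) that contains no point of $E$. Consider sequences $\tilde h=\{h_n\}_{n\in\mathbb N}$ of positive reals with $h_n\downarrow0$ (decreasing to $0$). $\tilde E$ is the set of such sequences with $h_n\in E\setminus\{0\}$ for all $n$; $\tilde H(E)$ is the set of such sequences with $\lambda(E,0,h_n)/h_n\to1$ as $n\to\infty$. For sequences of positive numbers, $\{a_n\}\asymp\{\gamma_n\}$ means that there are constants $c_1,c_2>0$ with $c_1a_n\le\gamma_n\le c_2a_n$ for all $n$. A set $E\subseteq\mathbb R^{+}$ is completely strongly porous on the right at $0$ if for every $\tilde\tau\in\tilde E$ there is $\tilde h\in\tilde H(E)$ with $\tilde\tau\asymp\tilde h$; $\mathbf{CSP}$ is the collection of all such $E$. $I(\mathbf{CSP})$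 (the ideal generated by $\mathbf{CSP}$) is the collection of all finite unions $A_1\cup\dots\cup A_n$, $n\in\mathbb N$, with $A_1,\dots,A_n\in\mathbf{CSP}$. For $q>1$, the $q$-blow up of $E$ is $E(q):=\bigcup_{x\in E}(q^{-1}x,qx)$ (for $x=0$ the interval is empty). $\mathrm{Cc}^{1}E(q)$ is the set of those connected components of $E(q)$ that are contained in $(0,1]$; these are open intervals. For nonempty $A,B\subseteq\mathbb R^{+}$ write $A\prec B$ if $b<a$ for all $a\in A$, $b\in B$. When $\mathrm{Cc}^{1}E(q)$ is infinite, there is a unique sequence of intervals $\{(a_i,b_i)\}_{i\in\mathbb N}$ that enumerates exactly the elements of $\mathrm{Cc}^{1}E(q)$ and satisfies $(a_i,b_i)\prec(a_j,b_j)\Leftrightarrow i<j$ (that is, the components are listed from right to left); the notation $\mathrm{Cc}^{1}E(q)=\{(a_i,b_i)\}_{i\in\mathbb N}$ refers to this enumeration, which depends on $q$. *)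

theory Defs
  imports "HOL-Analysis.Analysis"
begin

text \<open>
  Sequences are functions on \<open>nat\<close> and are therefore indexed from \<open>0\<close> instead of \<open>1\<close>; every
  notion below is invariant under this shift of the index.
\<close>

text \<open>
  The lengths of the (possibly empty) open subintervals of \<open>(0,h)\<close> that miss \<open>E\<close> form a nonempty
  set bounded by \<open>h\<close> (for \<open>h > 0\<close>), and the supremum is attained.
\<close>
definition gap_length :: "real set \<Rightarrow> real \<Rightarrow> real" where
  "gap_length E h = Sup {b - a | a b. 0 \<le> a \<and> a \<le> b \<and> b \<le> h \<and> {a<..<b} \<inter> E = {}}"

definition decreasing_null_seq :: "(nat \<Rightarrow> real) \<Rightarrow> bool" where
  "decreasing_null_seq h \<longleftrightarrow> (\<forall>n. h n > 0) \<and> decseq h \<and> h \<longlonglongrightarrow> 0"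

definition E_seqs :: "real set \<Rightarrow> (nat \<Rightarrow> real) set" where
  "E_seqs E = {h. decreasing_null_seq h \<and> (\<forall>n. h n \<in> E - {0})}"

definition H_seqs :: "real set \<Rightarrow> (nat \<Rightarrow> real) set" where
  "H_seqs E = {h. decreasing_null_seq h \<and> (\<lambda>n. gap_length E (h n) / h n) \<longlonglongrightarrow> 1}"

definition seq_equiv :: "(nat \<Rightarrow> real) \<Rightarrow> (nat \<Rightarrow> real) \<Rightarrow> bool" where
  "seq_equiv a g \<longleftrightarrow> (\<exists>c1>0. \<exists>c2>0. \<forall>n. c1 * a n \<le> g n \<and> g n \<le> c2 * a n)"

definition CSP :: "real set set" where
  "CSP = {E. E \<subseteq> {0..} \<and> (\<forall>\<tau>\<in>E_seqs E. \<exists>h\<in>H_seqs E. seq_equiv \<tau> h)}"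

definition generated_ideal :: "'a set set \<Rightarrow> 'a set set" where
  "generated_ideal \<C> = {\<Union>i\<in>{1..n}. A i | (n::nat) A. n \<ge> 1 \<and> (\<forall>i\<in>{1..n}. A i \<in> \<C>)}"

definition blow_up :: "real \<Rightarrow> real set \<Rightarrow> real set" where
  "blow_up q E = (\<Union>x\<in>E. {x / q<..<q * x})"

definition Cc1 :: "real set \<Rightarrow> real \<Rightarrow> real set set" where
  "Cc1 E q = {C \<in> components (blow_up q E). C \<subseteq> {0<..1}}"

text \<open>\<open>set_prec A B\<close> means that \<open>A\<close> lies to the right of \<open>B\<close>; it is only meant for nonempty sets.\<close>
definition set_prec :: "real set \<Rightarrow> real set \<Rightarrow> bool" where
  "set_prec A B \<longleftrightarrow> (\<forall>a\<in>A. \<forall>b\<in>B. b < a)"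

text \<open>
  The intervals \<open>(a i, b i)\<close> are automatically nonempty, being components, and so \<open>a\<close> and \<open>b\<close>
  are determined by them.
\<close>
definition enumerates_Cc1 :: "real set \<Rightarrow> real \<Rightarrow> (nat \<Rightarrow> real) \<Rightarrow> (nat \<Rightarrow> real) \<Rightarrow> bool" where
  "enumerates_Cc1 E q a b \<longleftrightarrow>
     range (\<lambda>i. {a i<..<b i}) = Cc1 E q \<and>
     (\<forall>i j. set_prec {a i<..<b i} {a j<..<b j} \<longleftrightarrow> i < j)"

lemma set_prec_intervalD:
  assumes "set_prec {a<..<b} {c<..<d}" "a < b" "c < d"
  shows "d \<le> a"
proof (rule ccontr)
  assume "\<not> d \<le> a"
  then have "max a c < d" using assms by auto
  then obtain y where y: "max a c < y" "y < d" using dense by blast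
  have "a < min y b" using y assms by auto
  then obtain z where "a < z" "z < min y b" using dense by blast
  then have "z \<in> {a<..<b}" "y \<in> {c<..<d}" "z < y" using y by simp_all
  then show False using assms(1) unfolding set_prec_def by (meson less_asym)
qed

lemma Cc1_interval:
  assumes "C \<in> Cc1 E q"
  obtains a b where "a < b" "0 \<le> a" "b \<le> 1" "C = {a<..<b}"
proof -
  have "open (blow_up q E)" by (auto simp: blow_up_def)
  then have op: "open C" using assms open_components by (auto simp: Cc1_def)
  have comp: "C \<in> components (blow_up q E)" and sub: "C \<subseteq> {0<..1}"
    using assms by (auto simp: Cc1_def)
  have con: "connected C" and ne: "C \<noteq> {}"
    using in_components_connected[OF comp] in_components_nonempty[OF comp] by blast+
  have bd: "bdd_below C" "bdd_above C"
    using sub by (auto intro!: bdd_belowI[of _ 0] bdd_aboveI[of _ 1])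
  have lo: "Inf C < x" and hi: "x < Sup C" if x: "x \<in> C" for x
  proof -
    obtain e where e: "e > 0" "ball x e \<subseteq> C" using op x by (meson openE)
    have "x - e / 2 \<in> C" "x + e / 2 \<in> C" using e by (auto simp: dist_real_def subset_iff)
    then have "Inf C \<le> x - e / 2" "x + e / 2 \<le> Sup C"
      using bd by (auto intro: cInf_lower cSup_upper)
    then show "Inf C < x" "x < Sup C" using e by auto
  qed
  have "y \<in> C" if y: "Inf C < y" "y < Sup C" for y
  proof -
    obtain u where "u \<in> C" "u < y" using y(1) cInf_lessD[OF ne] by metis
    moreover obtain v where "v \<in> C" "y < v" using y(2) less_cSupD[OF ne] by metis
    ultimately show ?thesis using connectedD_interval[OF con, of u v y] by simp
  qed
  then have "C = {Inf C<..<Sup C}" using lo hi by auto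
  moreover have "0 \<le> Inf C" using ne sub by (intro cInf_greatest) auto
  moreover have "Sup C \<le> 1" using ne sub by (intro cSup_least) auto
  moreover have "Inf C < Sup C" using ne lo hi by force
  ultimately show ?thesis using that by blast
qed

lemma set_prec_total:
  assumes "C \<in> Cc1 E q" "D \<in> Cc1 E q" "C \<noteq> D"
  shows "set_prec C D \<or> set_prec D C"
proof -
  obtain a b where C: "a < b" "C = {a<..<b}" using Cc1_interval[OF assms(1)] by metis
  obtain c d where D: "c < d" "D = {c<..<d}" using Cc1_interval[OF assms(2)] by metis
  have disj: "C \<inter> D = {}"
    using assms components_nonoverlap[of C "blow_up q E" D] by (auto simp: Cc1_def)
  have "d \<le> a \<or> b \<le> c"
  proof (rule ccontr)
    assume "\<not> ?thesis"
    then obtain z where "max a c < z" "z < min b d" using C D dense[of "max a c" "min b d"] by auto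
    then show False using disj C D by auto
  qed
  then show ?thesis by (auto simp: C D set_prec_def)
qed

lemma set_prec_asym:
  assumes "C \<in> Cc1 E q" "D \<in> Cc1 E q" "set_prec C D"
  shows "\<not> set_prec D C"
proof -
  obtain c where "c \<in> C"
    using Cc1_interval[OF assms(1)] dense by (metis greaterThanLessThan_iff)
  moreover obtain d where "d \<in> D"
    using Cc1_interval[OF assms(2)] dense by (metis greaterThanLessThan_iff)
  ultimately show ?thesis using assms(3) unfolding set_prec_def by (meson less_asym)
qed

lemma set_prec_trans:
  assumes "D \<in> Cc1 E q" "set_prec B D" "set_prec D C"
  shows "set_prec B C"
proof -
  obtain d where "d \<in> D"
    using Cc1_interval[OF assms(1)] dense by (metis greaterThanLessThan_iff)
  then show ?thesis using assms(2,3) unfolding set_prec_def by (meson less_trans)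
qed

lemma finite_set_prec:
  assumes q: "q > 1" and C: "C \<in> Cc1 E q"
  shows "finite {D \<in> Cc1 E q. set_prec D C}"
proof -
  obtain c d where cd: "c < d" "0 \<le> c" "C = {c<..<d}" using Cc1_interval[OF C] by metis
  define e where "e = d * (q - 1 / q)"
  have "1 / q < 1" using q by simp
  then have "d * (q - 1 / q) > 0" using cd q by (intro mult_pos_pos) linarith+
  then have e: "e > 0" by (simp add: e_def)
  let ?X = "{D \<in> Cc1 E q. set_prec D C}"
  have len: "d \<le> a \<and> e \<le> b - a" if D: "{a<..<b} \<in> ?X" and "a < b" for a b
  proof -
    have da: "d \<le> a" using set_prec_intervalD[of a b c d] D cd \<open>a < b\<close> by simp
    obtain y where y: "a < y" "y < b" using \<open>a < b\<close> dense by blast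
    have co: "{a<..<b} \<in> components (blow_up q E)" using D by (auto simp: Cc1_def)
    then have "y \<in> blow_up q E" using y in_components_subset by fastforce
    then obtain x where x: "x \<in> E" "x / q < y" "y < q * x" by (auto simp: blow_up_def)
    have "{x / q<..<q * x} \<subseteq> {a<..<b}"
    proof (rule components_maximal[OF co])
      show "connected {x / q<..<q * x}" by simp
      show "{x / q<..<q * x} \<subseteq> blow_up q E" using x(1) by (auto simp only: blow_up_def)
      show "{a<..<b} \<inter> {x / q<..<q * x} \<noteq> {}" using x y by fastforce
    qed
    moreover have "x / q < q * x" using x by linarith
    ultimately have xb: "a \<le> x / q" "q * x \<le> b"
      unfolding greaterThanLessThan_subseteq_greaterThanLessThan by blast+
    have "d \<le> x / q" using da xb by linarith
    moreover have "0 < d" using cd by auto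
    ultimately have "0 < x" using q by (smt (verit) divide_nonpos_pos)
    then have "x / q \<le> x" using q by (simp add: divide_le_eq)
    then have dx: "d \<le> x" using \<open>d \<le> x / q\<close> by linarith
    have "e \<le> x * (q - 1 / q)"
      unfolding e_def using dx q \<open>1 / q < 1\<close> by (intro mult_right_mono) linarith+
    also have "\<dots> = q * x - x / q" by (simp add: algebra_simps)
    also have "\<dots> \<le> b - a" using xb by linarith
    finally show ?thesis using da by blast
  qed
  have step: "Sup D + e \<le> Sup D'" if D: "D \<in> ?X" "D' \<in> ?X" "set_prec D' D" for D D'
  proof -
    obtain a b where ab: "a < b" "D = {a<..<b}" using D Cc1_interval by (metis mem_Collect_eq)
    obtain a' b' where ab': "a' < b'" "D' = {a'<..<b'}" using D Cc1_interval by (metis mem_Collect_eq)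
    have "b \<le> a'" using set_prec_intervalD D(3) ab ab' by blast
    moreover have "e \<le> b' - a'" using len D(2) ab' by blast
    ultimately show ?thesis using ab ab' by simp
  qed
  have inj: "inj_on (\<lambda>D. \<lfloor>Sup D / e\<rfloor>) ?X"
  proof (rule inj_onI, rule ccontr)
    have lt: "\<lfloor>Sup D / e\<rfloor> < \<lfloor>Sup D' / e\<rfloor>"
      if D: "D \<in> ?X" "D' \<in> ?X" "set_prec D' D" for D D'
    proof -
      have "Sup D / e + 1 \<le> Sup D' / e" 
        using divide_right_mono[OF step[OF D], of e] e by (simp add: add_divide_distrib)
      then show ?thesis by linarith
    qed
    fix D D' assume D: "D \<in> ?X" "D' \<in> ?X" "\<lfloor>Sup D / e\<rfloor> = \<lfloor>Sup D' / e\<rfloor>" "D \<noteq> D'"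
    then have "set_prec D D' \<or> set_prec D' D" using set_prec_total by blast
    then show False using lt[OF D(1,2)] lt[OF D(2,1)] D(3) by auto
  qed
  have "(\<lambda>D. \<lfloor>Sup D / e\<rfloor>) ` ?X \<subseteq> {0..\<lfloor>1 / e\<rfloor>}"
  proof
    fix z assume "z \<in> (\<lambda>D. \<lfloor>Sup D / e\<rfloor>) ` ?X"
    then obtain D where D: "D \<in> Cc1 E q" "z = \<lfloor>Sup D / e\<rfloor>" by auto
    obtain a b where ab: "a < b" "0 \<le> a" "b \<le> 1" "D = {a<..<b}" using Cc1_interval[OF D(1)] .
    have "0 \<le> b / e" "b / e \<le> 1 / e" using ab e by (auto intro: divide_right_mono)
    then show "z \<in> {0..\<lfloor>1 / e\<rfloor>}" using D ab by (auto intro: floor_mono)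
  qed
  then have "finite ((\<lambda>D. \<lfloor>Sup D / e\<rfloor>) ` ?X)" using finite_subset by blast
  then show ?thesis using inj finite_imageD by blast
qed

lemma enumerates_Cc1_exists:
  assumes q: "q > 1" and inf: "infinite (Cc1 E q)"
  shows "\<exists>a b. enumerates_Cc1 E q a b"
proof -
  let ?X = "Cc1 E q"
  define r where "r C = card {D \<in> ?X. set_prec D C}" for C
  have mono: "r C < r D" if "C \<in> ?X" "D \<in> ?X" "set_prec C D" for C D
    unfolding r_def
  proof (rule psubset_card_mono)
    show "finite {B \<in> ?X. set_prec B D}" using finite_set_prec q that by blast
    have "C \<notin> {B \<in> ?X. set_prec B C}" using set_prec_asym that by blast
    then show "{B \<in> ?X. set_prec B C} \<subset> {B \<in> ?X. set_prec B D}"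
      using that set_prec_trans by blast
  qed
  have iff: "set_prec C D \<longleftrightarrow> r C < r D" if "C \<in> ?X" "D \<in> ?X" for C D
  proof (cases "C = D")
    case True
    then show ?thesis using set_prec_asym[OF that] by auto
  next
    case False
    then show ?thesis
      using mono[OF that] mono[OF that(2,1)] set_prec_total[OF that] by fastforce
  qed
  have inj: "inj_on r ?X"
  proof (rule inj_onI, rule ccontr)
    fix C D assume "C \<in> ?X" "D \<in> ?X" "r C = r D" "C \<noteq> D"
    then show False using mono[of C D] mono[of D C] set_prec_total[of C E q D] by linarith
  qed
  have infr: "infinite (r ` ?X)" using inf inj finite_imageD by blast
  define f where "f i = inv_into ?X r (enumerate (r ` ?X) i)" for i
  have fX: "f i \<in> ?X" and rf: "r (f i) = enumerate (r ` ?X) i" for i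
    using enumerate_in_set[OF infr, of i] unfolding f_def
    by (auto intro: inv_into_into simp: f_inv_into_f)
  have ran: "range f = ?X"
  proof
    show "?X \<subseteq> range f"
    proof
      fix C assume C: "C \<in> ?X"
      then obtain i where "enumerate (r ` ?X) i = r C"
        using enumerate_Ex[OF infr, of "r C"] by auto
      then have "f i = C" using C inj by (simp add: f_def)
      then show "C \<in> range f" by auto
    qed
  qed (use fX in auto)
  have "\<forall>i. \<exists>a b. f i = {a<..<b}" using fX Cc1_interval by metis
  then obtain a b where ab: "\<And>i. f i = {a i<..<b i}" by metis
  have "set_prec (f i) (f j) \<longleftrightarrow> i < j" for i j
    using iff[OF fX fX] infr by (simp add: rf)
  then have "enumerates_Cc1 E q a b"
    using ran by (simp add: enumerates_Cc1_def ab[symmetric])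
  then show ?thesis by blast
qed

end

theory Submission
  imports Defs
begin

text \<open>
  A set is in \<open>CSP\<close> iff, near \<open>0\<close>, its points form clusters of bounded ratio \<open>K\<close> separated by gaps
  whose ratio tends to infinity (\<open>gap_condition\<close>). If \<open>E\<close> is a union of \<open>N\<close> such sets, then by the
  pigeonhole principle \<open>N + 1\<close> small points of \<open>E\<close> with consecutive ratios above \<open>K\<close> have an
  arbitrarily large total ratio. Hence components of a blow-up cannot be long, and \<open>N + 1\<close>
  consecutive gaps between components cannot all be short. Conversely, if among any \<open>M + 1\<close>
  consecutive gaps one is large, then the parts of \<open>E\<close> in the components whose index lies in a fixed
  residue class modulo \<open>M + 1\<close> satisfy the gap condition.
\<close>

section \<open>Porosity in terms of ratios of points\<close>

text \<open>Near \<open>0\<close> a ratio \<open>x / y\<close> is either at most \<open>K\<close> or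
  at least \<open>1 / \<epsilon>\<close>, written without division. Being uniform in the points,
  this replaces the choice of a sequence \<open>h\<close> for each sequence \<open>\<tau>\<close>;
  \<open>0 < y\<close> admits sets containing \<open>0\<close>.\<close>

definition gap_condition :: "real \<Rightarrow> real set \<Rightarrow> bool" where
  "gap_condition K A \<longleftrightarrow>
     (\<forall>\<epsilon>>0. \<exists>\<delta>>0. \<forall>x\<in>A. \<forall>y\<in>A. x < \<delta> \<longrightarrow> 0 < y \<longrightarrow> K * y < x \<longrightarrow> y \<le> \<epsilon> * x)"

text \<open>Lets finitely many sets share the largest of their constants.\<close>

lemma gap_condition_mono:
  assumes "gap_condition K A" "K \<le> L"
  shows "gap_condition L A"
  unfolding gap_condition_def
proof (intro allI impI)
  fix \<epsilon> :: real assume "\<epsilon> > 0"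
  then obtain \<delta> where d: "\<delta> > 0"
    "\<And>x y. x \<in> A \<Longrightarrow> y \<in> A \<Longrightarrow> x < \<delta> \<Longrightarrow> 0 < y \<Longrightarrow> K * y < x \<Longrightarrow> y \<le> \<epsilon> * x"
    using assms(1) unfolding gap_condition_def by meson
  have "K * y < x" if "0 < y" "L * y < x" for x y
    using mult_right_mono[OF assms(2), of y] that by linarith
  then show "\<exists>\<delta>>0. \<forall>x\<in>A. \<forall>y\<in>A. x < \<delta> \<longrightarrow> 0 < y \<longrightarrow> L * y < x \<longrightarrow> y \<le> \<epsilon> * x"
    using d by blast
qed

lemma gap_length_upper:
  assumes "0 \<le> a" "a \<le> b" "b \<le> h" "{a<..<b} \<inter> E = {}"
  shows "b - a \<le> gap_length E h"
  unfolding gap_length_def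
proof (rule cSup_upper)
  show "b - a \<in> {b - a | a b. 0 \<le> a \<and> a \<le> b \<and> b \<le> h \<and> {a<..<b} \<inter> E = {}}"
    using assms by blast
  show "bdd_above {b - a | a b. 0 \<le> a \<and> a \<le> b \<and> b \<le> h \<and> {a<..<b} \<inter> E = {}}"
    by (rule bdd_aboveI[of _ h]) auto
qed

lemma gap_lengths_nonempty:
  assumes "0 \<le> (h::real)"
  shows "{b - a | a b. 0 \<le> a \<and> a \<le> b \<and> b \<le> h \<and> {a<..<b} \<inter> E = {}} \<noteq> {}"
proof -
  have "{0<..<0::real} \<inter> E = {}" by simp
  then show ?thesis using assms by blast
qed

lemma gap_length_le:
  assumes "0 \<le> h"
  shows "gap_length E h \<le> h"
  unfolding gap_length_def using gap_lengths_nonempty[OF assms] by (rule cSup_least) auto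

lemma less_gap_lengthE:
  assumes "c < gap_length E h" "0 \<le> h"
  obtains a b where "0 \<le> a" "a \<le> b" "b \<le> h" "{a<..<b} \<inter> E = {}" "c < b - a"
  using less_cSupD[OF gap_lengths_nonempty[OF assms(2)] assms(1)[unfolded gap_length_def]] by blast

text \<open>By contradiction: if every constant fails, the pairs violating the condition for the
  constants \<open>k + 1\<close> supply one null sequence \<open>\<tau>\<close> in \<open>A\<close>
  that meets every \<open>k\<close> infinitely often. For \<open>h\<close> comparable to
  \<open>\<tau>\<close> almost all of \<open>(0, h n)\<close> is eventually free of
  \<open>A\<close>, but the smaller point of a suitable pair lies in the free interval.\<close>

lemma CSP_imp_gap_condition:
  assumes "A \<in> CSP"
  shows "\<exists>K\<ge>1. gap_condition K A"
proof (rule ccontr)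
  assume no: "\<not> ?thesis"
  have "\<forall>k::nat. \<exists>\<epsilon>>0. \<forall>\<delta>>0. \<exists>x\<in>A. \<exists>y\<in>A. x < \<delta> \<and> 0 < y \<and> real (Suc k) * y < x \<and> \<epsilon> * x < y"
  proof
    fix k :: nat
    have "\<not> gap_condition (real (Suc k)) A" using no by auto
    then obtain \<epsilon> where "\<epsilon> > 0" and e: "\<And>\<delta>. \<delta> > 0 \<Longrightarrow>
        \<not> (\<forall>x\<in>A. \<forall>y\<in>A. x < \<delta> \<longrightarrow> 0 < y \<longrightarrow> real (Suc k) * y < x \<longrightarrow> y \<le> \<epsilon> * x)"
      unfolding gap_condition_def by blast
    have "\<exists>x\<in>A. \<exists>y\<in>A. x < \<delta> \<and> 0 < y \<and> real (Suc k) * y < x \<and> \<epsilon> * x < y" if "\<delta> > 0" for \<delta>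
      using e[OF that] not_le by blast
    then show "\<exists>\<epsilon>>0. \<forall>\<delta>>0. \<exists>x\<in>A. \<exists>y\<in>A. x < \<delta> \<and> 0 < y \<and> real (Suc k) * y < x \<and> \<epsilon> * x < y"
      using \<open>\<epsilon> > 0\<close> by blast
  qed
  then obtain \<epsilon> where e: "\<And>k. \<epsilon> k > 0"
    "\<And>k \<delta>. \<delta> > 0 \<Longrightarrow>
      \<exists>x\<in>A. \<exists>y\<in>A. x < \<delta> \<and> 0 < y \<and> real (Suc k) * y < x \<and> \<epsilon> k * x < y"
    by metis
  \<comment> \<open>Every value \<open>k\<close> is taken by \<open>\<kappa>\<close> infinitely often.\<close>
  define \<kappa> where "\<kappa> n = fst (prod_decode n)" for n
  \<comment> \<open>The bound \<open>1 / real (Suc n)\<close> forces convergence to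
    \<open>0\<close>; the point \<open>y\<close> is the partner of \<open>x\<close> in a violating
    pair for \<open>\<kappa> n\<close>.\<close>
  define P where "P n x \<longleftrightarrow> x \<in> A \<and> 0 < x \<and> x < 1 / real (Suc n) \<and>
    (\<exists>y\<in>A. 0 < y \<and> real (Suc (\<kappa> n)) * y < x \<and> \<epsilon> (\<kappa> n) * x < y)" for n x
  have ex: "\<exists>x. P n x \<and> x < \<delta>" if "\<delta> > 0" for n \<delta>
  proof -
    have "min \<delta> (1 / real (Suc n)) > 0" using that by simp
    from e(2)[OF this, of "\<kappa> n"] obtain x y where
      xy: "x \<in> A" "y \<in> A" "x < min \<delta> (1 / real (Suc n))" "0 < y"
        "real (Suc (\<kappa> n)) * y < x" "\<epsilon> (\<kappa> n) * x < y" by blast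
    have "0 \<le> real (Suc (\<kappa> n)) * y" using xy(4) by simp
    then have "0 < x" using xy(5) by linarith
    then show ?thesis using xy unfolding P_def by auto
  qed
  have "\<exists>\<tau>. \<forall>n. P n (\<tau> n) \<and> \<tau> (Suc n) < \<tau> n"
  proof (rule dependent_nat_choice)
    show "\<exists>x. P 0 x" using ex[of 1 0] by auto
    show "\<exists>y. P (Suc n) y \<and> y < x" if "P n x" for x n
      using ex[of x "Suc n"] that by (simp add: P_def)
  qed
  then obtain \<tau> where t: "\<And>n. P n (\<tau> n)" "\<And>n. \<tau> (Suc n) < \<tau> n" by blast
  have tpos: "\<tau> n > 0" for n using t(1)[of n] by (simp add: P_def)
  have "\<tau> \<longlonglongrightarrow> 0"
  proof (rule tendsto_sandwich[of "\<lambda>_. 0" _ _ "\<lambda>n. 1 / real (Suc n)"])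
    show "\<forall>\<^sub>F n in sequentially. \<tau> n \<le> 1 / real (Suc n)"
      using t(1) by (auto simp: P_def less_imp_le)
    show "(\<lambda>n. 1 / real (Suc n)) \<longlonglongrightarrow> 0"
      using LIMSEQ_inverse_real_of_nat by (simp add: inverse_eq_divide)
  qed (use tpos in \<open>auto simp: less_imp_le\<close>)
  moreover have "decseq \<tau>" using t(2) by (intro decseq_SucI less_imp_le)
  moreover have "\<tau> n \<in> A - {0}" for n using t(1)[of n] by (simp add: P_def)
  ultimately have "\<tau> \<in> E_seqs A"
    using tpos by (simp add: E_seqs_def decreasing_null_seq_def)
  then obtain h where h: "h \<in> H_seqs A" "seq_equiv \<tau> h" using assms by (auto simp: CSP_def)
  then obtain c1 c2 where c: "c1 > 0" "c2 > 0" "\<And>n. c1 * \<tau> n \<le> h n" "\<And>n. h n \<le> c2 * \<tau> n"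
    by (auto simp: seq_equiv_def)
  \<comment> \<open>Chosen so that the partner \<open>y\<close> of \<open>\<tau> n\<close> satisfies
    \<open>y < h n / 2\<close>, by means of \<open>c1 * \<tau> n \<le> h n\<close>.\<close>
  obtain k where k: "1 / real (Suc k) < c1 / 2"
    using c(1) nat_approx_posE[of "c1 / 2"] by auto
  \<comment> \<open>\<open>\<eta> \<le> 1 / 2\<close> puts the right end of the free interval beyond
    \<open>h n / 2\<close>, and \<open>\<eta> * c2 \<le> \<epsilon> k\<close> puts its left end
    below \<open>y\<close>.\<close>
  define \<eta> where "\<eta> = min (1 / 2) (\<epsilon> k / c2)"
  have eta: "\<eta> > 0" "\<eta> \<le> 1 / 2" "\<eta> * c2 \<le> \<epsilon> k"
    using e(1)[of k] c(2) by (auto simp: \<eta>_def min_def field_simps)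
  have lim: "(\<lambda>n. gap_length A (h n) / h n) \<longlonglongrightarrow> 1" and hpos: "\<And>n. h n > 0"
    using h(1) by (auto simp: H_seqs_def decreasing_null_seq_def)
  have "\<forall>\<^sub>F n in sequentially. 1 - \<eta> < gap_length A (h n) / h n"
    using order_tendstoD(1)[OF lim, of "1 - \<eta>"] eta(1) by simp
  then obtain n0 where n0: "\<And>n. n \<ge> n0 \<Longrightarrow> 1 - \<eta> < gap_length A (h n) / h n"
    by (auto simp: eventually_sequentially)
  \<comment> \<open>An index of at least \<open>n0\<close> at which \<open>\<kappa>\<close> takes
    the value \<open>k\<close>.\<close>
  define n where "n = prod_encode (k, n0)"
  have "n \<ge> n0" unfolding n_def by (rule le_prod_encode_2)
  then have "(1 - \<eta>) * h n < gap_length A (h n)"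
    using n0[of n] hpos[of n] by (simp add: pos_less_divide_eq)
  then obtain u v where uv: "0 \<le> u" "u \<le> v" "v \<le> h n" "{u<..<v} \<inter> A = {}"
    "(1 - \<eta>) * h n < v - u"
    using less_gap_lengthE hpos[of n] by (metis less_imp_le)
  have "\<kappa> n = k" by (simp add: \<kappa>_def n_def)
  then obtain y where y: "y \<in> A" "0 < y" "real (Suc k) * y < \<tau> n" "\<epsilon> k * \<tau> n < y"
    using t(1)[of n] by (auto simp: P_def)
  have "u < \<eta> * h n" using uv by (simp add: algebra_simps)
  also have "\<dots> \<le> \<eta> * (c2 * \<tau> n)" using eta(1) c(4) by (intro mult_left_mono) auto
  also have "\<dots> \<le> \<epsilon> k * \<tau> n"
    using mult_right_mono[OF eta(3), of "\<tau> n"] tpos[of n] by (simp add: mult.assoc)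
  finally have uy: "u < y" using y(4) by linarith
  have "y < 1 / real (Suc k) * \<tau> n" using y(3) by (simp add: field_simps)
  also have "\<dots> < c1 / 2 * \<tau> n" using k tpos by (intro mult_strict_right_mono)
  also have "\<dots> \<le> 1 / 2 * h n" using c(3)[of n] by simp
  also have "\<dots> \<le> (1 - \<eta>) * h n" using eta(2) hpos[of n] by (intro mult_right_mono) auto
  also have "\<dots> < v" using uv by linarith
  finally show False using uy uv(4) y(1) by auto
qed

text \<open>With \<open>h n = \<tau> n / K\<close> the condition clears the interval from
  \<open>\<epsilon> * \<tau> n\<close> to \<open>h n\<close> of points of \<open>A\<close> once
  \<open>\<tau> n\<close> is small. For small \<open>\<epsilon>\<close> this is nearly all of
  \<open>(0, h n)\<close>.\<close>

lemma gap_condition_imp_CSP: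
  assumes "A \<subseteq> {0..}" "gap_condition K A" "K > 0"
  shows "A \<in> CSP"
  unfolding CSP_def
proof (intro CollectI conjI ballI)
  fix \<tau> assume "\<tau> \<in> E_seqs A"
  then have t: "\<And>n. \<tau> n > 0" "decseq \<tau>" "\<tau> \<longlonglongrightarrow> 0" "\<And>n. \<tau> n \<in> A"
    by (auto simp: E_seqs_def decreasing_null_seq_def)
  define h where "h n = \<tau> n / K" for n
  have hpos: "h n > 0" for n using t(1) assms(3) by (simp add: h_def)
  have "decseq h" using t(2) assms(3) by (auto simp: h_def decseq_def divide_right_mono)
  moreover have "h \<longlonglongrightarrow> 0" unfolding h_def using tendsto_divide[OF t(3) tendsto_const[of K]] assms(3) by simp
  ultimately have dn: "decreasing_null_seq h" using hpos by (simp add: decreasing_null_seq_def)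
  have "(\<lambda>n. gap_length A (h n) / h n) \<longlonglongrightarrow> 1"
  proof (rule order_tendstoI)
    fix e :: real assume "1 < e"
    have "gap_length A (h n) / h n \<le> 1" for n
      using gap_length_le[of "h n" A] hpos[of n] by simp
    then show "\<forall>\<^sub>F n in sequentially. gap_length A (h n) / h n < e"
      using \<open>1 < e\<close> by (intro always_eventually allI) (rule le_less_trans)
  next
    fix e :: real assume "e < 1"
    \<comment> \<open>\<open>\<epsilon> * K \<le> 1\<close> keeps the ends of the free interval in
      order, and \<open>\<epsilon> * K < 1 - e\<close> makes it longer than
      \<open>e * h n\<close>.\<close>
    define \<epsilon> where "\<epsilon> = min 1 ((1 - e) / 2) / K"
    have eps: "\<epsilon> > 0" "\<epsilon> * K \<le> 1" "\<epsilon> * K < 1 - e"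
      using \<open>e < 1\<close> assms(3) by (auto simp: \<epsilon>_def min_def)
    obtain \<delta> where d: "\<delta> > 0"
      "\<And>x y. x \<in> A \<Longrightarrow> y \<in> A \<Longrightarrow> x < \<delta> \<Longrightarrow> 0 < y \<Longrightarrow> K * y < x \<Longrightarrow> y \<le> \<epsilon> * x"
      using assms(2) eps(1) unfolding gap_condition_def by meson
    have "e < gap_length A (h n) / h n" if "\<tau> n < \<delta>" for n
    proof -
      have eh: "\<epsilon> * \<tau> n = \<epsilon> * K * h n" using assms(3) by (simp add: h_def)
      have "\<not> (y \<in> A \<and> \<epsilon> * \<tau> n < y \<and> y < h n)" for y
      proof
        assume y: "y \<in> A \<and> \<epsilon> * \<tau> n < y \<and> y < h n"
        then have "0 < y" using eps(1) t(1)[of n] by (smt (verit) mult_pos_pos)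
        then show False using d(2)[of "\<tau> n" y] t(4)[of n] that y assms(3)
          by (auto simp: h_def field_simps)
      qed
      then have "{\<epsilon> * \<tau> n<..<h n} \<inter> A = {}" by auto
      moreover have "\<epsilon> * \<tau> n \<le> h n"
        unfolding eh using mult_right_mono[OF eps(2), of "h n"] hpos[of n] by simp
      moreover have "0 \<le> \<epsilon> * \<tau> n" using eps(1) t(1)[of n] by simp
      ultimately have "h n - \<epsilon> * \<tau> n \<le> gap_length A (h n)"
        by (intro gap_length_upper) simp_all
      moreover have "e * h n < (1 - \<epsilon> * K) * h n" using eps(3) hpos[of n] by (intro mult_strict_right_mono) auto
      ultimately have "e * h n < gap_length A (h n)" using eh by (simp add: algebra_simps)
      then show ?thesis using hpos[of n] by (simp add: pos_less_divide_eq)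
    qed
    moreover have "\<forall>\<^sub>F n in sequentially. \<tau> n < \<delta>" using order_tendstoD(2)[OF t(3)] d(1) by blast
    ultimately show "\<forall>\<^sub>F n in sequentially. e < gap_length A (h n) / h n"
      by (rule eventually_mono[rotated])
  qed
  then have "h \<in> H_seqs A" using dn by (simp add: H_seqs_def)
  moreover have "seq_equiv \<tau> h"
    unfolding seq_equiv_def
    using assms(3) by (intro exI[of _ "1 / K"] conjI) (auto simp: h_def)
  ultimately show "\<exists>h\<in>H_seqs A. seq_equiv \<tau> h" by blast
qed (use assms(1) in auto)

lemma CSP_iff_gap_condition:
  assumes "A \<subseteq> {0..}"
  shows "A \<in> CSP \<longleftrightarrow> (\<exists>K\<ge>1. gap_condition K A)"
  using CSP_imp_gap_condition gap_condition_imp_CSP[OF assms] by force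

section \<open>Chains of points in finite unions\<close>

text \<open>Two of the \<open>N + 1\<close> points lie in the same piece, where points at a ratio beyond \<open>K\<close> are
  very far apart.\<close>
lemma chain_ratio_unbounded:
  fixes N :: nat
  assumes "\<And>k. k \<in> {1..N} \<Longrightarrow> gap_condition K (A k)" "L > 0"
  obtains \<delta> where "\<delta> > 0"
    "\<forall>x :: nat \<Rightarrow> real. (\<forall>i\<le>N. x i \<in> (\<Union>k\<in>{1..N}. A k) \<and> 0 < x i \<and> x i < \<delta>) \<longrightarrow>
      (\<forall>i j. i < j \<longrightarrow> j \<le> N \<longrightarrow> K * x j < x i) \<longrightarrow> (\<exists>i j. i < j \<and> j \<le> N \<and> L * x j \<le> x i)"
proof -
  have "\<forall>k\<in>{1..N}. \<exists>\<delta>>0. \<forall>x\<in>A k. \<forall>y\<in>A k. x < \<delta> \<longrightarrow> 0 < y \<longrightarrow> K * y < x \<longrightarrow> y \<le> 1 / L * x"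
  proof
    fix k assume "k \<in> {1..N}"
    moreover have "1 / L > 0" using assms(2) by simp
    ultimately show "\<exists>\<delta>>0. \<forall>x\<in>A k. \<forall>y\<in>A k. x < \<delta> \<longrightarrow> 0 < y \<longrightarrow> K * y < x \<longrightarrow> y \<le> 1 / L * x"
      using assms(1) unfolding gap_condition_def by blast
  qed
  then obtain d where d: "\<And>k. k \<in> {1..N} \<Longrightarrow> d k > 0"
    "\<And>k x y. k \<in> {1..N} \<Longrightarrow> x \<in> A k \<Longrightarrow> y \<in> A k \<Longrightarrow> x < d k \<Longrightarrow> 0 < y \<Longrightarrow> K * y < x \<Longrightarrow> y \<le> 1 / L * x"
    by metis
  \<comment> \<open>The inserted \<open>1\<close> keeps the minimum meaningful for
    \<open>N = 0\<close>.\<close>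
  define \<delta> where "\<delta> = Min (insert 1 (d ` {1..N}))"
  have "\<delta> > 0" using d(1) by (simp add: \<delta>_def)
  moreover have "\<exists>i j. i < j \<and> j \<le> N \<and> L * x j \<le> x i"
    if x: "\<forall>i\<le>N. x i \<in> (\<Union>k\<in>{1..N}. A k) \<and> 0 < x i \<and> x i < \<delta>"
      and sep: "\<forall>i j. i < j \<longrightarrow> j \<le> N \<longrightarrow> K * x j < x i" for x :: "nat \<Rightarrow> real"
  proof -
    have "\<forall>i. \<exists>k. i \<le> N \<longrightarrow> k \<in> {1..N} \<and> x i \<in> A k" using x by blast
    from choice[OF this] obtain g where g: "\<forall>i. i \<le> N \<longrightarrow> g i \<in> {1..N} \<and> x i \<in> A (g i)" ..
    have "g ` {..N} \<subseteq> {1..N}" using g by blast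
    from card_mono[OF finite_atLeastAtMost this] have "\<not> inj_on g {..N}" by (intro pigeonhole) simp
    then obtain i j where "i \<le> N" "j \<le> N" "i \<noteq> j" "g i = g j" by (auto simp: inj_on_def)
    then obtain i j where ij: "i < j" "j \<le> N" "g i = g j" by (metis nat_neq_iff)
    have g': "g i \<in> {1..N}" "x i \<in> A (g i)" "x j \<in> A (g i)"
      using g ij less_imp_le[OF ij(1)] by (metis le_trans)+
    have "\<delta> \<le> d (g i)" using g'(1) unfolding \<delta>_def by (intro Min_le) blast+
    moreover have "x i < \<delta>" using x ij by (meson less_imp_le le_trans)
    ultimately have "x i < d (g i)" by linarith
    moreover have "0 < x j" "K * x j < x i" using x sep ij by blast+
    ultimately have "x j \<le> 1 / L * x i" using d(2) g' by blast
    then show ?thesis using ij assms(2) by (auto simp: field_simps)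
  qed
  ultimately show ?thesis using that by blast
qed

text \<open>If the ratio \<open>t / s\<close> were large, \<open>N + 1\<close> points spaced geometrically in the interval would
  come within a factor \<open>q\<close> of points of \<open>E\<close> violating the previous lemma.\<close>
lemma blow_up_interval_ratio:
  fixes N :: nat
  assumes "\<And>k. k \<in> {1..N} \<Longrightarrow> gap_condition K (A k)" "K \<ge> 1" "q > 1"
    and E: "E = (\<Union>k\<in>{1..N}. A k)"
  shows "\<exists>R>1. \<exists>\<delta>>0. \<forall>s t. 0 < s \<longrightarrow> t \<le> \<delta> \<longrightarrow> {s<..<t} \<subseteq> blow_up q E \<longrightarrow> t \<le> R * s"
proof -
  \<comment> \<open>Replacing two sample points by nearby points of \<open>E\<close> costs a factor
    \<open>q\<close> each, so spacing \<open>K * q\<^sup>2\<close> leaves a ratio above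
    \<open>K\<close>.\<close>
  define \<rho> where "\<rho> = K * q\<^sup>2"
  have "q\<^sup>2 > 1" using assms(3) by (simp add: one_less_power)
  then have rho: "\<rho> > 1" using mult_right_mono[OF assms(2), of "q\<^sup>2"] by (simp add: \<rho>_def)
  \<comment> \<open>The replaced points have ratios below \<open>L\<close>: sample ratios are at
    most \<open>\<rho> ^ N\<close>, and each replacement costs at most \<open>q\<close>.\<close>
  define L where "L = q\<^sup>2 * \<rho> ^ N"
  have "L > 0" using rho assms(3) by (simp add: L_def)
  obtain \<delta> where d: "\<delta> > 0" and chain: "\<forall>x :: nat \<Rightarrow> real. (\<forall>i\<le>N. x i \<in> E \<and> 0 < x i \<and> x i < \<delta>) \<longrightarrow>
      (\<forall>i j. i < j \<longrightarrow> j \<le> N \<longrightarrow> K * x j < x i) \<longrightarrow> (\<exists>i j. i < j \<and> j \<le> N \<and> L * x j \<le> x i)"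
    unfolding E by (rule chain_ratio_unbounded[OF assms(1) \<open>L > 0\<close>])
  \<comment> \<open>The bound \<open>\<delta> / q\<close> makes up for the factor \<open>q\<close>
    by which a point of \<open>E\<close> may exceed its sample point.\<close>
  have "t \<le> \<rho> ^ (N + 1) * s" if st: "0 < s" "t \<le> \<delta> / q" "{s<..<t} \<subseteq> blow_up q E" for s t
  proof (rule ccontr)
    assume "\<not> ?thesis"
    then have big: "\<rho> ^ (N + 1) * s < t" by simp
    moreover have "0 < \<rho> ^ (N + 1) * s" using rho st(1) by simp
    ultimately have t0: "0 < t" by linarith
    \<comment> \<open>The exponent \<open>i + 1\<close> keeps \<open>z 0\<close> strictly below
      \<open>t\<close>, while \<open>z N\<close> still exceeds \<open>s\<close> by the choice of the
      ratio \<open>\<rho> ^ (N + 1)\<close>.\<close>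
    define z where "z i = t / \<rho> ^ (i + 1)" for i
    have z: "s < z i \<and> z i < t" if "i \<le> N" for i
    proof
      have "\<rho> ^ (i + 1) * s \<le> \<rho> ^ (N + 1) * s"
        using rho st(1) that by (intro mult_right_mono power_increasing) auto
      then show "s < z i" using big rho by (simp add: z_def pos_less_divide_eq mult.commute)
      have "t * 1 < t * \<rho> ^ (i + 1)" using t0 rho one_less_power[of \<rho> "i + 1"] by (intro mult_strict_left_mono) auto
      then show "z i < t" using rho by (simp add: z_def pos_divide_less_eq)
    qed
    have zz: "z i = \<rho> ^ (j - i) * z j" if "i < j" for i j
    proof -
      have "\<rho> ^ (j + 1) = \<rho> ^ (j - i) * \<rho> ^ (i + 1)" using that by (simp flip: power_add)
      then show ?thesis using rho by (simp add: z_def)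
    qed
    have "\<forall>i. \<exists>x. i \<le> N \<longrightarrow> x \<in> E \<and> x / q < z i \<and> z i < q * x"
    proof
      fix i
      have "z i \<in> blow_up q E" if "i \<le> N" using z[OF that] st(3) by auto
      then show "\<exists>x. i \<le> N \<longrightarrow> x \<in> E \<and> x / q < z i \<and> z i < q * x"
        unfolding blow_up_def by auto
    qed
    from choice[OF this] obtain x where x: "\<forall>i. i \<le> N \<longrightarrow> x i \<in> E \<and> x i / q < z i \<and> z i < q * x i" ..
    have xz: "x i < q * z i" "z i < q * x i" if "i \<le> N" for i
      using x that assms(3) by (auto simp: field_simps)
    have q0: "q > 0" using assms(3) by simp
    have small: "x i \<in> E \<and> 0 < x i \<and> x i < \<delta>" if "i \<le> N" for i
    proof (intro conjI)
      have "0 < q * x i" using z[OF that] xz[OF that] st(1) by linarith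
      then show "0 < x i" using q0 by (simp add: zero_less_mult_iff)
      have "q * z i \<le> q * t" using z[OF that] q0 by simp
      moreover have "q * t \<le> \<delta>" using st(2) q0 by (simp add: field_simps)
      ultimately show "x i < \<delta>" using xz(1)[OF that] by linarith
    qed (use x that in auto)
    have ratio: "q * \<rho> ^ (j - i) * z j < q\<^sup>2 * x i" if "i < j" "j \<le> N" for i j
    proof -
      have "q * z i < q * (q * x i)" using xz(2)[of i] that q0 by (intro mult_strict_left_mono) auto
      then show ?thesis using zz[OF that(1)] by (simp add: power2_eq_square mult.assoc)
    qed
    have "K * x j < x i" if ij: "i < j" "j \<le> N" for i j
    proof -
      have "\<rho> ^ 1 \<le> \<rho> ^ (j - i)" using rho ij by (intro power_increasing) auto
      moreover have zj: "0 < z j" using z[of j] ij st(1) by auto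
      ultimately have "q * \<rho> * z j \<le> q * \<rho> ^ (j - i) * z j" using q0 by simp
      moreover have "\<rho> * x j < \<rho> * (q * z j)" using rho xz(1)[of j] ij by (intro mult_strict_left_mono) auto
      ultimately have "\<rho> * x j < q\<^sup>2 * x i" using ratio[OF ij] by (simp add: mult_ac)
      then have "q\<^sup>2 * (K * x j) < q\<^sup>2 * x i" by (simp add: \<rho>_def mult_ac)
      then show ?thesis using q0 by simp
    qed
    then have "\<forall>i j. i < j \<longrightarrow> j \<le> N \<longrightarrow> K * x j < x i" by blast
    moreover have "\<forall>i\<le>N. x i \<in> E \<and> 0 < x i \<and> x i < \<delta>" using small by blast
    ultimately obtain i j where ij: "i < j" "j \<le> N" "L * x j \<le> x i"
      using chain by blast
    have "x i < q * z i" using xz(1) ij by simp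
    also have "\<dots> = q * \<rho> ^ (j - i) * z j" using zz[OF ij(1)] by simp
    also have "\<dots> \<le> q * \<rho> ^ (j - i) * (q * x j)"
      using xz(2)[of j] ij q0 rho by (intro mult_left_mono) auto
    also have "\<dots> = q\<^sup>2 * \<rho> ^ (j - i) * x j" by (simp add: power2_eq_square)
    also have "\<dots> \<le> q\<^sup>2 * \<rho> ^ N * x j"
      using small[of j] ij rho by (intro mult_right_mono mult_left_mono power_increasing) auto
    finally show False using ij(3) by (simp add: L_def)
  qed
  then show ?thesis
    using rho d assms(3) by (intro exI[of _ "\<rho> ^ (N + 1)"] exI[of _ "\<delta> / q"] conjI) (auto simp: one_less_power simp del: power_Suc)
qed

section \<open>Components of the blow-up and their enumeration\<close>

text \<open>By maximality a component contains the whole blown-up interval of any point whose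
  interval meets it. That interval is nonempty, which rules out \<open>x \<le> 0\<close>. The margin
  \<open>q\<close> on both sides later separates points of different components.\<close>

lemma components_blow_upE:
  assumes "{a<..<b} \<in> components (blow_up q E)" "q > 1"
  obtains x where "x \<in> E" "0 < x" "a \<le> x / q" "q * x \<le> b"
proof -
  obtain y where y: "y \<in> {a<..<b}" using in_components_nonempty[OF assms(1)] by blast
  then have "y \<in> blow_up q E" using in_components_subset[OF assms(1)] by blast
  then obtain x where x: "x \<in> E" "x / q < y" "y < q * x" by (auto simp: blow_up_def)
  have lt: "x / q < q * x" using x by linarith
  have "{x / q<..<q * x} \<subseteq> {a<..<b}"
  proof (rule components_maximal[OF assms(1)])
    show "{x / q<..<q * x} \<subseteq> blow_up q E" using x(1) unfolding blow_up_def by blast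
    show "{a<..<b} \<inter> {x / q<..<q * x} \<noteq> {}" using x y by auto
  qed simp
  then have "a \<le> x / q" "q * x \<le> b"
    using lt unfolding greaterThanLessThan_subseteq_greaterThanLessThan by blast+
  moreover have "0 < x"
  proof (rule ccontr)
    assume "\<not> 0 < x"
    then have qx: "q * x \<le> x" using mult_right_mono_neg[of 1 q x] assms(2) by simp
    then have "x \<le> x / q" using assms(2) by (simp add: pos_le_divide_eq mult.commute)
    then show False using lt qx by linarith
  qed
  ultimately show thesis using that x(1) by blast
qed

text \<open>A blown-up interval around \<open>a\<close> would meet the component and hence, by
  maximality, be contained in it.\<close>

lemma left_endpoint_notin_blow_up:
  assumes "{a<..<b} \<in> components (blow_up q E)"
  shows "a \<notin> blow_up q E"
proof
  assume "a \<in> blow_up q E"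
  then obtain x where x: "x \<in> E" "x / q < a" "a < q * x" by (auto simp: blow_up_def)
  have "a < b" using in_components_nonempty[OF assms] by auto
  then obtain y where y: "a < y" "y < min b (q * x)" using x(3) dense[of a "min b (q * x)"] by auto
  have "{x / q<..<q * x} \<subseteq> {a<..<b}"
  proof (rule components_maximal[OF assms])
    show "{x / q<..<q * x} \<subseteq> blow_up q E" using x(1) unfolding blow_up_def by blast
    have "y \<in> {a<..<b} \<inter> {x / q<..<q * x}" using x y by auto
    then show "{a<..<b} \<inter> {x / q<..<q * x} \<noteq> {}" by blast
  qed simp
  moreover have "a \<in> {x / q<..<q * x}" using x by simp
  ultimately show False by auto
qed

text \<open>The component of \<open>x\<close> cannot jump over the missing point \<open>z\<close>,
  so it stays below \<open>1\<close>; it is positive because \<open>E\<close> is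
  nonnegative.\<close>

lemma in_Cc1_if_gap_to_the_right:
  assumes "E \<subseteq> {0..}" "q > 1" "x \<in> E" "0 < x" "x < z" "z \<le> 1" "z \<notin> blow_up q E"
  shows "\<exists>C\<in>Cc1 E q. x \<in> C"
proof -
  have "x / q < x" "x < q * x" using assms(2,4) by (auto simp: field_simps)
  then have "x \<in> blow_up q E" using assms(3) unfolding blow_up_def by auto
  then have "x \<in> \<Union> (components (blow_up q E))" by simp
  then obtain C where C: "C \<in> components (blow_up q E)" "x \<in> C" by blast
  have CB: "C \<subseteq> blow_up q E" using C(1) by (rule in_components_subset)
  have "y \<in> {0<..1}" if y: "y \<in> C" for y
  proof -
    obtain w where w: "w \<in> E" "w / q < y" using y CB by (auto simp: blow_up_def)
    have "0 \<le> w / q" using w(1) assms(1,2) by auto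
    moreover have "y \<le> 1"
    proof (rule ccontr)
      assume "\<not> y \<le> 1"
      then have "z \<in> C"
        using connectedD_interval[OF in_components_connected[OF C(1)] C(2) y] assms by auto
      then show False using CB assms by blast
    qed
    ultimately show ?thesis using w by auto
  qed
  then show ?thesis using C by (auto simp: Cc1_def)
qed

lemma enumerates_Cc1D:
  assumes "enumerates_Cc1 E q a b"
  shows "{a i<..<b i} \<in> components (blow_up q E)" "0 \<le> a i" "a i < b i" "b i \<le> 1"
proof -
  have C: "{a i<..<b i} \<in> Cc1 E q" using assms by (auto simp: enumerates_Cc1_def)
  then show comp: "{a i<..<b i} \<in> components (blow_up q E)" by (simp add: Cc1_def)
  show ab: "a i < b i" using in_components_nonempty[OF comp] by auto
  obtain c d where cd: "c < d" "0 \<le> c" "d \<le> 1" "{a i<..<b i} = {c<..<d}" using Cc1_interval[OF C] .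
  have "{a i<..<b i} \<subseteq> {c<..<d}" using cd(4) by simp
  then show "0 \<le> a i" "b i \<le> 1"
    using ab cd unfolding greaterThanLessThan_subseteq_greaterThanLessThan by linarith+
qed

lemma enumerates_Cc1_less:
  assumes "enumerates_Cc1 E q a b" "i < j"
  shows "b j \<le> a i"
  using set_prec_intervalD[of "a i" "b i" "a j" "b j"] enumerates_Cc1D(3)[OF assms(1)] assms
  by (auto simp: enumerates_Cc1_def)

text \<open>If \<open>a i\<close> were \<open>0\<close>, there would be no room for the component
  with index \<open>Suc i\<close>.\<close>

lemma enumerates_Cc1_pos:
  assumes "enumerates_Cc1 E q a b"
  shows "0 < a i"
  using enumerates_Cc1_less[OF assms lessI[of i]] enumerates_Cc1D(2,3)[OF assms, of "Suc i"]
  by linarith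

lemma enumerates_Cc1_antimono:
  assumes "enumerates_Cc1 E q a b" "i \<le> j"
  shows "b j \<le> b i"
proof (cases "i = j")
  case False
  then show ?thesis
    using enumerates_Cc1_less[OF assms(1), of i j] enumerates_Cc1D(3)[OF assms(1), of i] assms(2)
    by linarith
qed simp

text \<open>The endpoint \<open>a 0\<close> is outside the blow-up and thus stops the component of
  \<open>x\<close> on the right.\<close>

lemma enumerates_Cc1_cover:
  assumes "enumerates_Cc1 E q a b" "E \<subseteq> {0..}" "q > 1" "x \<in> E" "0 < x" "x < a 0"
  shows "\<exists>i. x \<in> {a i<..<b i}"
proof -
  have "a 0 \<le> 1" using enumerates_Cc1D(3,4)[OF assms(1), of 0] by linarith
  then obtain C where "C \<in> Cc1 E q" "x \<in> C"
    using in_Cc1_if_gap_to_the_right[OF assms(2-6)]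
      left_endpoint_notin_blow_up[OF enumerates_Cc1D(1)[OF assms(1)]] by blast
  moreover have "Cc1 E q = range (\<lambda>i. {a i<..<b i})" using assms(1) by (simp add: enumerates_Cc1_def)
  ultimately show ?thesis by blast
qed

lemma islimpt_0_obtains:
  assumes "0 islimpt E" "E \<subseteq> {0::real..}" "0 < \<eta>"
  obtains x where "x \<in> E" "0 < x" "x < \<eta>"
proof -
  obtain x where "x \<in> E" "x \<noteq> 0" "\<bar>x - 0\<bar> < \<eta>" using assms unfolding islimpt_approachable_real by blast
  then show thesis using that[of x] assms(2) by fastforce
qed

text \<open>Some point of \<open>E\<close> below \<open>\<eta>\<close> lies in a component, and all
  later components are to the left of that point.\<close>

lemma enumerates_Cc1_eventually_less:
  assumes "enumerates_Cc1 E q a b" "E \<subseteq> {0..}" "q > 1" "0 islimpt E" "0 < \<eta>"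
  shows "\<forall>\<^sub>F i in sequentially. b i < \<eta>"
proof -
  have "0 < min \<eta> (a 0)" using assms(5) enumerates_Cc1_pos[OF assms(1)] by simp
  then obtain x where x: "x \<in> E" "0 < x" "x < min \<eta> (a 0)" using islimpt_0_obtains assms by blast
  then obtain i where i: "x \<in> {a i<..<b i}" using enumerates_Cc1_cover[OF assms(1-3)] by auto
  have "b j < \<eta>" if "j > i" for j using enumerates_Cc1_less[OF assms(1) that] i x by auto
  then show ?thesis unfolding eventually_at_top_dense by blast
qed

section \<open>From the ideal to the components\<close>

text \<open>Bounded ratios keep every component away from \<open>0\<close>, so finitely many
  components would stay above some \<open>m > 0\<close>. A point of \<open>E\<close> below
  \<open>m\<close> nevertheless lies in a component, because a gap occurs to its right.\<close>

lemma infinite_Cc1: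
  fixes N :: nat
  assumes "\<And>k. k \<in> {1..N} \<Longrightarrow> gap_condition K (A k)" "K \<ge> 1" "q > 1"
    and E: "E = (\<Union>k\<in>{1..N}. A k)" and "E \<subseteq> {0..}" "0 islimpt E"
  shows "infinite (Cc1 E q)"
proof
  assume fin: "finite (Cc1 E q)"
  obtain R \<delta>0 where R: "R > 1" and d0: "\<delta>0 > 0"
    and ratio0: "\<forall>s t. 0 < s \<longrightarrow> t \<le> \<delta>0 \<longrightarrow> {s<..<t} \<subseteq> blow_up q E \<longrightarrow> t \<le> R * s"
    using blow_up_interval_ratio[OF assms(1-3) E] by blast
  \<comment> \<open>The cap \<open>1\<close> ensures that a gap found below \<open>\<delta>\<close>
    is at most \<open>1\<close>.\<close>
  define \<delta> where "\<delta> = min \<delta>0 1"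
  have d: "0 < \<delta>" "\<delta> \<le> 1" using d0 by (auto simp: \<delta>_def)
  have ratio: "t \<le> R * s" if "0 < s" "t \<le> \<delta>" "{s<..<t} \<subseteq> blow_up q E" for s t
    using ratio0 that unfolding \<delta>_def by simp
  have "\<forall>C\<in>Cc1 E q. \<exists>c>0. \<forall>y\<in>C. c < y"
  proof
    fix C assume C: "C \<in> Cc1 E q"
    obtain c e where ce: "c < e" "0 \<le> c" "C = {c<..<e}" using Cc1_interval[OF C] .
    have "c \<noteq> 0"
    proof
      assume "c = 0"
      \<comment> \<open>A component with left end \<open>0\<close> contains the interval from
        \<open>t / (2 * R)\<close> to \<open>t\<close>, whose ratio \<open>2 * R\<close> is too
        large.\<close>
      define t where "t = min e \<delta>"
      have t: "0 < t" "t \<le> \<delta>" using ce d \<open>c = 0\<close> by (auto simp: t_def)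
      have sub: "C \<subseteq> blow_up q E" using C by (auto simp: Cc1_def dest: in_components_subset)
      have "{t / (2 * R)<..<t} \<subseteq> C"
      proof
        fix y assume y: "y \<in> {t / (2 * R)<..<t}"
        have "0 < t / (2 * R)" using t R by simp
        then have "0 < y" "y < t" using y unfolding greaterThanLessThan_iff by linarith+
        then show "y \<in> C" using ce \<open>c = 0\<close> by (simp add: t_def)
      qed
      then have "t \<le> R * (t / (2 * R))" using t R sub by (intro ratio) auto
      then show False using t R by simp
    qed
    then show "\<exists>c>0. \<forall>y\<in>C. c < y" using ce by (intro exI[of _ c]) auto
  qed
  from bchoice[OF this] obtain c where c: "\<forall>C\<in>Cc1 E q. c C > 0 \<and> (\<forall>y\<in>C. c C < y)" by blast
  define m where "m = Min (insert 1 (c ` Cc1 E q))"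
  have m: "m > 0" "\<And>C. C \<in> Cc1 E q \<Longrightarrow> m \<le> c C" using fin c by (auto simp: m_def)
  \<comment> \<open>Below \<open>\<delta> / R\<close> the interval from \<open>x\<close> to
    \<open>\<delta>\<close> has ratio above \<open>R\<close> and must leave the blow-up.\<close>
  have "min m (\<delta> / R) > 0" using m d R by simp
  then obtain x where x: "x \<in> E" "0 < x" "x < min m (\<delta> / R)" using islimpt_0_obtains assms(5,6) by blast
  have xR: "R * x < \<delta>" using x(3) R by (simp add: field_simps)
  then have "\<not> {x<..<\<delta>} \<subseteq> blow_up q E" using ratio[of x \<delta>] x by auto
  then obtain z where z: "z \<in> {x<..<\<delta>}" "z \<notin> blow_up q E" by blast
  then obtain C where C: "C \<in> Cc1 E q" "x \<in> C"
    using in_Cc1_if_gap_to_the_right[OF assms(5,3) x(1,2), of z] d by auto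
  then have "c C < x" using c by blast
  then show False using m(2)[OF C(1)] x(3) by simp
qed

text \<open>The components shrink to \<open>0\<close>, so eventually the ratio bound for small
  intervals inside the blow-up applies to them.\<close>

lemma Cc1_ratio_bounded:
  fixes N :: nat
  assumes "\<And>k. k \<in> {1..N} \<Longrightarrow> gap_condition K (A k)" "K \<ge> 1" "q > 1"
    and E: "E = (\<Union>k\<in>{1..N}. A k)" and "E \<subseteq> {0..}" "0 islimpt E"
    and enum: "enumerates_Cc1 E q a b"
  shows "\<exists>R>1. \<forall>\<^sub>F i in sequentially. b i \<le> R * a i"
proof -
  obtain R \<delta> where R: "R > 1" and d: "\<delta> > 0"
    and ratio: "\<forall>s t. 0 < s \<longrightarrow> t \<le> \<delta> \<longrightarrow> {s<..<t} \<subseteq> blow_up q E \<longrightarrow> t \<le> R * s"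
    using blow_up_interval_ratio[OF assms(1-3) E] by blast
  have "b i \<le> R * a i" if "b i < \<delta>" for i
    using ratio that enumerates_Cc1_pos[OF enum] in_components_subset[OF enumerates_Cc1D(1)[OF enum]]
    by (simp add: less_imp_le)
  then show ?thesis
    using enumerates_Cc1_eventually_less[OF enum assms(5,3,6) d] R
    by (intro exI[of _ R] conjI) (auto elim: eventually_mono)
qed

text \<open>If \<open>M + 1\<close> consecutive gaps had ratio below \<open>Z\<close>, then points of \<open>E\<close> chosen from the
  neighbouring components would be separated by factors \<open>q\<^sup>2 > K\<close> but have bounded ratio.\<close>
lemma Cc1_max_gap_unbounded:
  fixes N M :: nat
  assumes "\<And>k. k \<in> {1..N} \<Longrightarrow> gap_condition K (A k)" "K \<ge> 1" "q > 1" "q \<ge> K"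
    and E: "E = (\<Union>k\<in>{1..N}. A k)" and "E \<subseteq> {0..}" "0 islimpt E" "N \<le> M"
    and enum: "enumerates_Cc1 E q a b"
  shows "filterlim (\<lambda>n. MAX j\<in>{0..M}. a (n + j) / b (n + j + 1)) at_top sequentially"
  unfolding filterlim_at_top_ge[where c = 1]
proof (intro allI impI)
  fix Z :: real assume Z: "1 \<le> Z"
  note pos = enumerates_Cc1_pos[OF enum]
  note anti = enumerates_Cc1_antimono[OF enum]
  have bpos: "0 < b i" for i using pos[of i] enumerates_Cc1D(3)[OF enum, of i] by linarith
  obtain R where R: "R > 1" and ev: "\<forall>\<^sub>F i in sequentially. b i \<le> R * a i"
    using Cc1_ratio_bounded[OF assms(1-3) E assms(6,7) enum] by blast
  obtain n0 where n0: "\<And>i. i \<ge> n0 \<Longrightarrow> b i \<le> R * a i" using ev by (auto simp: eventually_sequentially)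
  \<comment> \<open>Bounds \<open>b (n + j) / b (n + j + 1)\<close>: a factor \<open>R\<close> for
    the component and \<open>Z\<close> for the gap. With \<open>Z \<ge> 1\<close> the powers of
    \<open>W\<close> are nondecreasing.\<close>
  define W where "W = R * Z"
  have W: "W \<ge> 1" using R Z mult_mono[of 1 R 1 Z] by (simp add: W_def)
  \<comment> \<open>At most \<open>N\<close> steps of ratio \<open>W\<close> plus one factor
    \<open>R\<close> to cross the last component, so no ratio of the chosen points reaches
    \<open>L\<close>.\<close>
  define L where "L = W ^ N * R"
  have "L > 0" using W R by (simp add: L_def)
  obtain \<delta> where d: "\<delta> > 0" and chain: "\<forall>x :: nat \<Rightarrow> real. (\<forall>i\<le>N. x i \<in> E \<and> 0 < x i \<and> x i < \<delta>) \<longrightarrow>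
      (\<forall>i j. i < j \<longrightarrow> j \<le> N \<longrightarrow> K * x j < x i) \<longrightarrow> (\<exists>i j. i < j \<and> j \<le> N \<and> L * x j \<le> x i)"
    unfolding E by (rule chain_ratio_unbounded[OF assms(1) \<open>L > 0\<close>])
  have key: "Z \<le> (MAX j\<in>{0..M}. a (n + j) / b (n + j + 1))" if n: "n \<ge> n0" "b n < \<delta>" for n
  proof (rule ccontr)
    assume "\<not> ?thesis"
    then have lt: "(MAX j\<in>{0..M}. a (n + j) / b (n + j + 1)) < Z" unfolding not_le .
    have gap: "a (n + j) \<le> Z * b (n + j + 1)" if "j \<le> M" for j
    proof -
      have "a (n + j) / b (n + j + 1) \<le> (MAX j\<in>{0..M}. a (n + j) / b (n + j + 1))"
        using that by (intro Max_ge) auto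
      then have "a (n + j) / b (n + j + 1) \<le> Z" using lt by linarith
      then show ?thesis using bpos[of "n + j + 1"] by (simp add: pos_divide_le_eq)
    qed
    have bW: "b n \<le> W ^ j * b (n + j)" if "j \<le> N" for j
      using that
    proof (induction j)
      case (Suc j)
      have "b (n + j) \<le> R * a (n + j)" using n0 n by simp
      also have "\<dots> \<le> R * (Z * b (n + j + 1))"
        using gap[of j] Suc.prems assms(8) R by (intro mult_left_mono) auto
      finally have "W ^ j * b (n + j) \<le> W ^ j * (W * b (n + Suc j))"
        using W by (intro mult_left_mono) (auto simp: W_def mult.assoc)
      then show ?case using Suc by (simp add: mult_ac)
    qed simp
    have "\<forall>j. \<exists>x. x \<in> E \<and> 0 < x \<and> a (n + j) \<le> x / q \<and> q * x \<le> b (n + j)"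
      using components_blow_upE[OF enumerates_Cc1D(1)[OF enum] assms(3)] by metis
    from choice[OF this] obtain x where
      x: "\<And>j. x j \<in> E" "\<And>j. 0 < x j" "\<And>j. a (n + j) \<le> x j / q" "\<And>j. q * x j \<le> b (n + j)"
      by blast
    have up: "x j < b (n + j)" and lo: "a (n + j) < x j" for j
    proof -
      have "1 * x j < q * x j" using x(2) assms(3) by (intro mult_strict_right_mono)
      then show "x j < b (n + j)" using x(4)[of j] by linarith
      have "x j / q < x j" using x(2)[of j] assms(3) by (simp add: pos_divide_less_eq)
      then show "a (n + j) < x j" using x(3)[of j] by linarith
    qed
    have "x i < \<delta>" for i using up[of i] anti[of n "n + i"] n(2) by simp
    then have "\<forall>i\<le>N. x i \<in> E \<and> 0 < x i \<and> x i < \<delta>" using x(1,2) by blast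
    moreover have "\<forall>i j. i < j \<longrightarrow> j \<le> N \<longrightarrow> K * x j < x i"
    proof (intro allI impI)
      fix i j :: nat assume "i < j"
      have "K * x j \<le> q * x j" using assms(4) x(2)[of j] by (intro mult_right_mono) auto
      also have "\<dots> \<le> b (n + j)" by (rule x(4))
      also have "\<dots> \<le> a (n + i)" using enumerates_Cc1_less[OF enum] \<open>i < j\<close> by simp
      also have "\<dots> < x i" by (rule lo)
      finally show "K * x j < x i" .
    qed
    ultimately obtain i j where ij: "j \<le> N" "L * x j \<le> x i" using chain by blast
    have "x i < b (n + i)" by (rule up)
    also have "\<dots> \<le> b n" by (rule anti) simp
    also have "\<dots> \<le> W ^ j * b (n + j)" using bW ij(1) .
    also have "\<dots> \<le> W ^ N * b (n + j)"
      using W ij(1) bpos[of "n + j"] by (intro mult_right_mono power_increasing) auto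
    also have "\<dots> \<le> W ^ N * (R * a (n + j))" using W n0 n by (intro mult_left_mono) auto
    also have "\<dots> = L * a (n + j)" by (simp add: L_def)
    also have "\<dots> < L * x j" using lo \<open>L > 0\<close> by (intro mult_strict_left_mono)
    finally show False using ij(2) by simp
  qed
  show "\<forall>\<^sub>F n in sequentially. Z \<le> (MAX j\<in>{0..M}. a (n + j) / b (n + j + 1))"
    using enumerates_Cc1_eventually_less[OF enum assms(6,3,7) d] eventually_ge_at_top[of n0]
    by eventually_elim (rule key)
qed

section \<open>From the components back to the ideal\<close>

text \<open>Any two distinct components in the same residue class modulo \<open>M + 1\<close> are separated by
  \<open>M + 1\<close> consecutive gaps, one of which is large.\<close>
lemma gap_condition_residue_class:
  assumes enum: "enumerates_Cc1 E q a b" and n0: "\<And>i. i \<ge> n0 \<Longrightarrow> b i \<le> C * a i"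
    and lim: "filterlim (\<lambda>n. MAX j\<in>{0..M}. a (n + j) / b (n + j + 1)) at_top sequentially"
  shows "gap_condition C (\<Union>i\<in>{i. i mod Suc M = k}. {a i<..<b i})"
  unfolding gap_condition_def
proof (intro allI impI)
  fix \<epsilon> :: real assume eps: "\<epsilon> > 0"
  note pos = enumerates_Cc1_pos[OF enum]
  note anti = enumerates_Cc1_antimono[OF enum]
  have bpos: "0 < b i" for i using pos[of i] enumerates_Cc1D(3)[OF enum, of i] by linarith
  have "\<forall>\<^sub>F n in sequentially. 1 / \<epsilon> \<le> (MAX j\<in>{0..M}. a (n + j) / b (n + j + 1))"
    using lim unfolding filterlim_at_top by blast
  then obtain n1 where n1: "\<And>n. n \<ge> n1 \<Longrightarrow> 1 / \<epsilon> \<le> (MAX j\<in>{0..M}. a (n + j) / b (n + j + 1))"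
    by (auto simp: eventually_sequentially)
  have "y \<le> \<epsilon> * x"
    if x: "x \<in> {a i<..<b i}" "i mod Suc M = k" and y: "y \<in> {a l<..<b l}" "l mod Suc M = k"
      and small: "x < a (max n0 n1)" and sep: "C * y < x" and "0 < y" for x y i l
  proof -
    \<comment> \<open>The threshold \<open>a (max n0 n1)\<close> serves as \<open>\<delta>\<close>:
      a point below it lies in a component where both eventual bounds hold.\<close>
    have i: "i \<ge> max n0 n1"
    proof (rule ccontr)
      assume "\<not> ?thesis"
      then have "b (max n0 n1) \<le> a i" unfolding not_le by (rule enumerates_Cc1_less[OF enum])
      then show False using x(1) small enumerates_Cc1D(3)[OF enum, of "max n0 n1"] by auto
    qed
    have "C > 0" using n0[of i] i pos[of i] bpos[of i] by (smt (verit) max.bounded_iff mult_nonpos_nonneg)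
    \<comment> \<open>Two points of one such component have ratio less than
      \<open>C\<close>.\<close>
    have "i \<noteq> l"
    proof
      assume "i = l"
      then have "C * a i < C * y" using y \<open>C > 0\<close> by simp
      then show False using n0[of i] i x(1) sep by auto
    qed
    show ?thesis
    proof (cases "l < i")
      \<comment> \<open>This case is contradictory: \<open>y\<close> lies to the right of
        \<open>x\<close>, whereas \<open>C \<ge> 1\<close> and \<open>C * y < x\<close> give
        \<open>y < x\<close>.\<close>
      case True
      then have "x < y" using enumerates_Cc1_less[OF enum True] x(1) y(1) by auto
      moreover have "C \<ge> 1"
      proof (rule ccontr)
        assume "\<not> C \<ge> 1"
        then have "C * a i < 1 * a i" using pos[of i] by (intro mult_strict_right_mono) auto
        then show False using n0[of i] i enumerates_Cc1D(3)[OF enum, of i] by simp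
      qed
      then have "1 * y \<le> C * y" using \<open>0 < y\<close> by (intro mult_right_mono) auto
      ultimately show ?thesis using sep by linarith
    next
      case False
      then have "i < l" using \<open>i \<noteq> l\<close> by simp
      \<comment> \<open>Equal residues put the indices at least \<open>M + 1\<close> apart, so every
        gap entering the maximum at \<open>i\<close> lies between \<open>y\<close> and
        \<open>x\<close>.\<close>
      moreover have "Suc M dvd l - i" using x(2) y(2) \<open>i < l\<close> by (metis mod_eq_dvd_iff_nat less_imp_le)
      ultimately have il: "i + M + 1 \<le> l" by (auto dest!: dvd_imp_le)
      have "(MAX j\<in>{0..M}. a (i + j) / b (i + j + 1)) \<in> (\<lambda>j. a (i + j) / b (i + j + 1)) ` {0..M}"
        by (intro Max_in) auto
      then obtain j where "j \<in> {0..M}"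
        and j_Max: "(MAX j\<in>{0..M}. a (i + j) / b (i + j + 1)) = a (i + j) / b (i + j + 1)"
        by (elim imageE)
      then have j: "j \<le> M" by simp
      have "1 / \<epsilon> \<le> a (i + j) / b (i + j + 1)" using n1[of i] i j_Max by simp
      then have "b (i + j + 1) \<le> \<epsilon> * a (i + j)" using eps bpos[of "i + j + 1"] by (simp add: field_simps)
      moreover have "y < b l" "b l \<le> b (i + j + 1)" using y anti[of "i + j + 1" l] il j by auto
      moreover have "a (i + j) \<le> a i"
        using enumerates_Cc1_less[OF enum, of i "i + j"] enumerates_Cc1D(3)[OF enum, of "i + j"]
        by (cases "j = 0") auto
      then have "\<epsilon> * a (i + j) \<le> \<epsilon> * x" using x eps by (intro mult_left_mono) auto
      ultimately show ?thesis by linarith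
    qed
  qed
  then show "\<exists>\<delta>>0. \<forall>x\<in>\<Union>i\<in>{i. i mod Suc M = k}. {a i<..<b i}.
      \<forall>y\<in>\<Union>i\<in>{i. i mod Suc M = k}. {a i<..<b i}. x < \<delta> \<longrightarrow> 0 < y \<longrightarrow> C * y < x \<longrightarrow> y \<le> \<epsilon> * x"
    using pos[of "max n0 n1"] by (intro exI[of _ "a (max n0 n1)"]) blast
qed

lemma gap_condition_subset: "gap_condition K B \<Longrightarrow> A \<subseteq> B \<Longrightarrow> gap_condition K A"
  unfolding gap_condition_def by (meson subsetD)

text \<open>Holds vacuously; meant for the part of \<open>E\<close> that no enumerated component
  covers.\<close>

lemma gap_condition_away_from_0:
  assumes "\<And>x. x \<in> A \<Longrightarrow> 0 < x \<Longrightarrow> c \<le> x" "c > 0" "K > 0"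
  shows "gap_condition K A"
  unfolding gap_condition_def
proof (intro allI impI exI[of _ c] conjI ballI)
  fix \<epsilon> x y assume "x \<in> A" "x < c" "0 < y" "K * y < x"
  moreover have "0 < K * y" using \<open>0 < y\<close> assms(3) by simp
  ultimately show "y \<le> \<epsilon> * x" using assms(1)[of x] by linarith
qed (rule assms(2))

text \<open>\<open>E\<close> splits into \<open>M + 1\<close> pieces, one for each residue of the
  component index, and a remainder that stays at or above \<open>a 0\<close> apart from possibly
  \<open>0\<close>.\<close>

lemma generated_idealI:
  assumes "E \<subseteq> {0..}" "q > 1" "enumerates_Cc1 E q a b"
    "limsup (\<lambda>i. ereal (b i / a i)) < \<infinity>"
    "filterlim (\<lambda>n. MAX j\<in>{0..M}. a (n + j) / b (n + j + 1)) at_top sequentially"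
  shows "E \<in> generated_ideal CSP"
proof -
  note pos = enumerates_Cc1_pos[OF assms(3)]
  obtain C0 :: real where "limsup (\<lambda>i. ereal (b i / a i)) < ereal C0"
    using assms(4) less_PInf_Ex_of_nat by auto
  then have "\<forall>\<^sub>F i in sequentially. ereal (b i / a i) < ereal C0" by (rule Limsup_lessD)
  then obtain n0 where n0: "\<And>i. i \<ge> n0 \<Longrightarrow> b i / a i < C0" by (auto simp: eventually_sequentially)
  define C where "C = max C0 1"
  have C: "b i \<le> C * a i" if "i \<ge> n0" for i
  proof -
    have "b i / a i \<le> C" using n0[OF that] by (simp add: C_def)
    then show ?thesis using pos[of i] by (simp add: pos_divide_le_eq)
  qed
  have "C \<ge> 1" by (simp add: C_def)
  \<comment> \<open>The union is indexed from \<open>1\<close>: the piece \<open>k\<close> carries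
    the residue \<open>k - 1\<close>, and \<open>M + 2\<close> is reserved for the
    remainder.\<close>
  define A where "A k = (if k = M + 2 then E - (\<Union>i. {a i<..<b i})
    else E \<inter> (\<Union>i\<in>{i. i mod Suc M = k - 1}. {a i<..<b i}))" for k
  have AE: "A k \<subseteq> E" for k by (auto simp: A_def)
  have "gap_condition C (A k)" for k
  proof (cases "k = M + 2")
    case True
    show ?thesis
    proof (rule gap_condition_away_from_0)
      fix x assume "x \<in> A k" "0 < x"
      then show "a 0 \<le> x"
        using enumerates_Cc1_cover[OF assms(3,1,2), of x] True by (force simp: A_def)
    qed (use pos \<open>C \<ge> 1\<close> in auto)
  next
    case False
    show ?thesis
      by (rule gap_condition_subset[OF gap_condition_residue_class[OF assms(3) C assms(5)]])
        (use False in \<open>auto simp: A_def\<close>)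
  qed
  then have "A k \<in> CSP" for k
    using CSP_iff_gap_condition[of "A k"] AE[of k] assms(1) \<open>C \<ge> 1\<close> by blast
  moreover have "E = (\<Union>k\<in>{1..M + 2}. A k)"
  proof
    show "E \<subseteq> (\<Union>k\<in>{1..M + 2}. A k)"
    proof
      fix x assume "x \<in> E"
      show "x \<in> (\<Union>k\<in>{1..M + 2}. A k)"
      proof (cases "\<exists>i. x \<in> {a i<..<b i}")
        case True
        then obtain i where i: "x \<in> {a i<..<b i}" by blast
        have "i mod Suc M < Suc M" by simp
        then have "i mod Suc M + 1 \<in> {1..M + 2}" "i mod Suc M + 1 \<noteq> M + 2"
          unfolding atLeastAtMost_iff by linarith+
        moreover from this(2) have "x \<in> A (i mod Suc M + 1)"
          using i \<open>x \<in> E\<close> unfolding A_def by auto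
        ultimately show ?thesis by blast
      next
        case False
        then have "x \<in> A (M + 2)" using \<open>x \<in> E\<close> by (simp add: A_def)
        then show ?thesis by force
      qed
    qed
  qed (use AE in blast)
  moreover have "M + 2 \<ge> 1" by simp
  ultimately show ?thesis unfolding generated_ideal_def by blast
qed

text \<open>The maximum of the finitely many constants works for all pieces.\<close>

lemma generated_idealD:
  assumes "E \<in> generated_ideal CSP"
  obtains N :: nat and K A where "K \<ge> 1" "E = (\<Union>k\<in>{1..N}. A k)"
    "\<forall>k\<in>{1..N}. gap_condition K (A k)"
proof -
  obtain N :: nat and A where A: "E = (\<Union>k\<in>{1..N}. A k)" "\<forall>k\<in>{1..N}. A k \<in> CSP"
    using assms unfolding generated_ideal_def by blast
  then have "\<forall>k\<in>{1..N}. \<exists>K\<ge>1. gap_condition K (A k)" using CSP_imp_gap_condition by blast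
  from bchoice[OF this] obtain K where K: "\<forall>k\<in>{1..N}. K k \<ge> 1 \<and> gap_condition (K k) (A k)" by blast
  define K0 where "K0 = Max (insert 1 (K ` {1..N}))"
  show thesis
  proof (rule that)
    show "K0 \<ge> 1" unfolding K0_def by (intro Max_ge) auto
    have "K k \<le> K0" if "k \<in> {1..N}" for k
      unfolding K0_def using that by (intro Max_ge) blast+
    then show "\<forall>k\<in>{1..N}. gap_condition K0 (A k)" using K gap_condition_mono by blast
  qed (rule A(1))
qed

theorem theorem7p6:
  fixes E :: "real set"
  assumes "E \<subseteq> {0..}" and "0 islimpt E"
  shows "E \<in> generated_ideal CSP \<longleftrightarrow>
    (\<forall>q>1. infinite (Cc1 E q)) \<and>
    (\<exists>q0>1. \<exists>M::nat. M \<ge> 1 \<and>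
      (\<forall>q>q0. \<forall>a b. enumerates_Cc1 E q a b \<longrightarrow>
        limsup (\<lambda>i. ereal (b i / a i)) < \<infinity> \<and>
        filterlim (\<lambda>n. MAX j\<in>{0..M}. a (n + j) / b (n + j + 1)) at_top sequentially))"
    (is "_ \<longleftrightarrow> ?inf \<and> ?enum")
proof
  assume "E \<in> generated_ideal CSP"
  then obtain N :: nat and K A where K: "K \<ge> 1" and E: "E = (\<Union>k\<in>{1..N}. A k)"
    and "\<forall>k\<in>{1..N}. gap_condition K (A k)" by (rule generated_idealD)
  then have A: "gap_condition K (A k)" if "k \<in> {1..N}" for k using that by blast
  have ?inf using infinite_Cc1[OF A K _ E assms] by blast
  moreover have ?enum
  \<comment> \<open>\<open>K + 1\<close> exceeds \<open>1\<close> and forces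
    \<open>q \<ge> K\<close>; \<open>N + 1\<close> is a positive integer not below the number of
    pieces.\<close>
  proof (intro exI[of _ "K + 1"] exI[of _ "N + 1"] conjI allI impI)
    fix q a b assume q: "K + 1 < q" and enum: "enumerates_Cc1 E q a b"
    have q': "q > 1" "q \<ge> K" using q K by auto
    obtain R where R: "\<forall>\<^sub>F i in sequentially. b i \<le> R * a i"
      using Cc1_ratio_bounded[OF A K q'(1) E assms enum] by blast
    have "\<forall>\<^sub>F i in sequentially. ereal (b i / a i) \<le> ereal R"
      using R enumerates_Cc1_pos[OF enum] by (auto elim!: eventually_mono simp: pos_divide_le_eq)
    then have "limsup (\<lambda>i. ereal (b i / a i)) \<le> ereal R" by (rule Limsup_bounded)
    then show "limsup (\<lambda>i. ereal (b i / a i)) < \<infinity>" by (rule le_less_trans) simp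
    show "filterlim (\<lambda>n. MAX j\<in>{0..N + 1}. a (n + j) / b (n + j + 1)) at_top sequentially"
      by (rule Cc1_max_gap_unbounded[OF A K q' E assms le_add1 enum])
  qed (use K in auto)
  ultimately show "?inf \<and> ?enum" ..
next
  assume R: "?inf \<and> ?enum"
  then obtain q0 M where q0: "q0 > 1" and enum: "\<forall>q>q0. \<forall>a b. enumerates_Cc1 E q a b \<longrightarrow>
        limsup (\<lambda>i. ereal (b i / a i)) < \<infinity> \<and>
        filterlim (\<lambda>n. MAX j\<in>{0..M}. a (n + j) / b (n + j + 1)) at_top sequentially" by blast
  \<comment> \<open>The decomposition is built from one blow-up, with factor \<open>q0 + 1\<close>;
    its infinitely many components yield the enumeration.\<close>
  have q: "q0 + 1 > 1" "q0 + 1 > q0" using q0 by auto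
  then obtain a b where "enumerates_Cc1 E (q0 + 1) a b" using enumerates_Cc1_exists R by blast
  then show "E \<in> generated_ideal CSP" using enum q generated_idealI[OF assms(1) q(1)] by blast
qed

end
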